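(* Let $G$ be a perfectly orderable graph with a perfect ordering $(v_1,\dots,v_n)$ of its vertex set. Index the stable sets $S_1,\dots,S_m$ of $G$ so that $$\mathbf{t}^{\rho(S_1)}>_{\rm lex}\cdots>_{\rm lex}\mathbf{t}^{\rho(S_m)},$$ where $>_{\rm lex}$ is the lexicographic order on $K[t_1,\dots,t_n]$ induced by $t_1>\cdots>t_n$ (the variable $t_i$ corresponding to the vertex $v_i$). Let $>_{\rm rev}$ be the reverse lexicographic order on $K[x_1,\dots,x_m]$ induced by the ordering $x_1<\cdots<x_m$, where $x_i$ is the variable corresponding to $S_i$. Then the initial ideal of the toric ideal $I_G\subset K[x_1,\dots,x_m]$ of the stable set polytope of $G$ with respect to $>_{\rm rev}$ is squarefree and quadratic, i.e., it is generated by squarefree monomials of degree $2$.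
   Context: All graphs are finite and simple. Let $G$ be a graph on the vertex set $\{v_1,\dots,v_n\}$. An ordering $(v_1,\dots,v_n)$ of the vertices is called perfect if for any induced subgraph $H$ of $G$ (with the induced ordering of its vertices), the number of colors used by Greedy Coloring on $H$ equals the chromatic number of $H$. Here Greedy Coloring processes the vertices in the given order and assigns to each vertex the smallest positive integer not already assigned to one of its previously colored neighbors. (Equivalently, by a known theorem, a vertex ordering $<$ is perfect if and only if $G$ contains no induced path $P_4$ on four vertices $abcd$, with edges $ab,bc,cd$, such that $a<b$ and $d<c$.) A graph is perfectly orderable if it has a perfect ordering of its vertex set. Identify $v_i$ with $i\in[n]=\{1,\dots,n\}$. A subset $S$ of the vertex set is a stable set of $G$ if no two distinct elements of $S$ are adjacent; the empty set and singletons are stable. Let $S(G)=\{S_1,\dots,S_m\}$ be the set of all stable sets of $G$, and put $\rho(S)=\sum_{v_j\in S}\mathbf{e}_j\in\mathbb{R}^n$, where $\mathbf{e}_j$ is the $j$-th unit coordinate vector. The stable set polytope of $G$ is the convex hull of $\{\rho(S_1),\dots,\rho(S_m)\}$. Let $K$ be a field. The toric ideal $I_G$ of the stable set polytope of $G$ is the kernel of the $K$-algebra homomorphism $\pi_G:K[x_1,\dots,x_m]\to K[t_1,\dots,t_n,s]$ given by $\pi_G(x_i)=\mathbf{t}^{\rho(S_i)}s$, where $\mathbf{t}^{\mathbf{a}}=t_1^{a_1}\cdots t_n^{a_n}$. The initial ideal of $I_G$ is the monomial ideal generated by the initial (largest) monomials of all nonzero elements of $I_G$. The (graded) reverse lexicographic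 order induced by $x_1<\cdots<x_m$ is the monomial order in which $x_1^{a_1}\cdots x_m^{a_m}>_{\rm rev}x_1^{b_1}\cdots x_m^{b_m}$ if either $\sum a_i>\sum b_i$, or $\sum a_i=\sum b_i$ and $a_i<b_i$ for the smallest index $i$ with $a_i\ne b_i$. Convention: if $I_G=\{0\}$ (which happens exactly when $G$ is complete), the zero initial ideal counts as squarefree and quadratic. *)

theory Defs
  imports "HOL-Library.Poly_Mapping"
begin

section \<open>Graphs, greedy colouring, perfect orderings\<close>

definition simple_graph :: "'v set \<Rightarrow> 'v set set \<Rightarrow> bool" where
  "simple_graph V E \<longleftrightarrow> finite V \<and> (\<forall>e\<in>E. e \<subseteq> V \<and> card e = 2)"

definition induced_edges :: "'v set \<Rightarrow> 'v set set \<Rightarrow> 'v set set" where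
  "induced_edges W E = {e \<in> E. e \<subseteq> W}"

definition proper_coloring :: "'v set \<Rightarrow> 'v set set \<Rightarrow> ('v \<Rightarrow> nat) \<Rightarrow> bool" where
  "proper_coloring V E c \<longleftrightarrow> (\<forall>u\<in>V. \<forall>w\<in>V. {u, w} \<in> E \<longrightarrow> c u \<noteq> c w)"

definition chromatic_number :: "'v set \<Rightarrow> 'v set set \<Rightarrow> nat" where
  "chromatic_number V E = (LEAST k. \<exists>c. proper_coloring V E c \<and> c ` V \<subseteq> {1..k})"

text \<open>Colours are positive integers; the value 0 marks a vertex that has not been coloured yet.\<close>

definition greedy_step :: "'v set set \<Rightarrow> ('v \<Rightarrow> nat) \<Rightarrow> 'v \<Rightarrow> ('v \<Rightarrow> nat)" where
  "greedy_step E c w = c(w := (LEAST k. k \<ge> 1 \<and> (\<forall>u. {u, w} \<in> E \<longrightarrow> c u \<noteq> k)))"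

definition greedy_coloring :: "'v set set \<Rightarrow> 'v list \<Rightarrow> ('v \<Rightarrow> nat)" where
  "greedy_coloring E ws = foldl (greedy_step E) (\<lambda>_. 0) ws"

text \<open>The ordering of the vertices is \<open>v 1, \<dots>, v n\<close>; filtering the list gives the induced
  ordering of the vertices of an induced subgraph.\<close>

definition perfect_ordering :: "'v set \<Rightarrow> 'v set set \<Rightarrow> nat \<Rightarrow> (nat \<Rightarrow> 'v) \<Rightarrow> bool" where
  "perfect_ordering V E n v \<longleftrightarrow>
     bij_betw v {1..n} V \<and>
     (\<forall>W \<subseteq> V.
        card (greedy_coloring (induced_edges W E)
                (filter (\<lambda>w. w \<in> W) (map v [1..<Suc n])) ` W)
        = chromatic_number W (induced_edges W E))"

definition stable_sets :: "'v set \<Rightarrow> 'v set set \<Rightarrow> 'v set set" where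
  "stable_sets V E = {S. S \<subseteq> V \<and> (\<forall>u\<in>S. \<forall>w\<in>S. u \<noteq> w \<longrightarrow> {u, w} \<notin> E)}"


section \<open>Polynomials and ideals\<close>

text \<open>Monomials are exponent vectors; a polynomial maps monomials to coefficients, and
  multiplication of polynomials is convolution.\<close>

type_synonym monomial = "nat \<Rightarrow>\<^sub>0 nat"
type_synonym 'k mpoly = "monomial \<Rightarrow>\<^sub>0 'k"

definition monomial_degree :: "monomial \<Rightarrow> nat" where
  "monomial_degree a = (\<Sum>i\<in>Poly_Mapping.keys a. Poly_Mapping.lookup a i)"

text \<open>The polynomial ring $K[x_1,\ldots,x_m]$, as a subset of the ring in the variables
  $x_0, x_1, x_2, \ldots$.\<close>

definition poly_ring :: "nat \<Rightarrow> ('k::field) mpoly set" where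
  "poly_ring m = {p. \<forall>a\<in>Poly_Mapping.keys p. Poly_Mapping.keys a \<subseteq> {1..m}}"

definition ideal_generated :: "nat \<Rightarrow> ('k::field) mpoly set \<Rightarrow> 'k mpoly set" where
  "ideal_generated m B =
     {(\<Sum>b\<in>T. r b * b) | T r. finite T \<and> T \<subseteq> B \<and> (\<forall>b\<in>T. r b \<in> poly_ring m)}"

text \<open>The $K$-algebra homomorphism that sends the variable $x_i$ to \<open>f i\<close>.\<close>

definition algebra_hom :: "(nat \<Rightarrow> 'k mpoly) \<Rightarrow> ('k::field) mpoly \<Rightarrow> 'k mpoly" where
  "algebra_hom f p =
     (\<Sum>a\<in>Poly_Mapping.keys p.
        Poly_Mapping.single 0 (Poly_Mapping.lookup p a)
        * (\<Prod>i\<in>Poly_Mapping.keys a. f i ^ Poly_Mapping.lookup a i))"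

text \<open>\<open>revlex_greater a b\<close> means that \<open>a\<close> is larger than \<open>b\<close>; the variable of smallest index is
  the smallest one.\<close>

definition revlex_greater :: "monomial \<Rightarrow> monomial \<Rightarrow> bool" where
  "revlex_greater a b \<longleftrightarrow>
     monomial_degree a > monomial_degree b \<or>
     monomial_degree a = monomial_degree b \<and>
       (\<exists>i. Poly_Mapping.lookup a i < Poly_Mapping.lookup b i \<and>
            (\<forall>j<i. Poly_Mapping.lookup a j = Poly_Mapping.lookup b j))"

definition is_initial_monomial ::
    "(monomial \<Rightarrow> monomial \<Rightarrow> bool) \<Rightarrow> ('k::field) mpoly \<Rightarrow> monomial \<Rightarrow> bool" where
  "is_initial_monomial gr p a \<longleftrightarrow>
     a \<in> Poly_Mapping.keys p \<and> (\<forall>b\<in>Poly_Mapping.keys p. b \<noteq> a \<longrightarrow> gr a b)"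

definition initial_ideal ::
    "nat \<Rightarrow> (monomial \<Rightarrow> monomial \<Rightarrow> bool) \<Rightarrow> ('k::field) mpoly set \<Rightarrow> 'k mpoly set" where
  "initial_ideal m gr I =
     ideal_generated m
       {Poly_Mapping.single a 1 | a. \<exists>p\<in>I. p \<noteq> 0 \<and> is_initial_monomial gr p a}"

text \<open>The zero ideal is included (take \<open>M = {}\<close>).\<close>

definition squarefree_quadratic :: "nat \<Rightarrow> ('k::field) mpoly set \<Rightarrow> bool" where
  "squarefree_quadratic m J \<longleftrightarrow>
     (\<exists>M. (\<forall>a\<in>M. Poly_Mapping.keys a \<subseteq> {1..m} \<and> monomial_degree a = 2 \<and>
                  (\<forall>i. Poly_Mapping.lookup a i \<le> 1)) \<and>
          J = ideal_generated m ((\<lambda>a. Poly_Mapping.single a 1) ` M))"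


section \<open>The toric ideal of the stable set polytope\<close>

text \<open>In the target ring $K[t_1,\ldots,t_n,s]$ the variable $t_j$ has index $j$ and the variable
  $s$ has index 0. The exponent vector of $\mathbf{t}^{\rho(S)}$:\<close>

definition rho :: "nat \<Rightarrow> (nat \<Rightarrow> 'v) \<Rightarrow> 'v set \<Rightarrow> monomial" where
  "rho n v S = (\<Sum>j\<in>{j\<in>{1..n}. v j \<in> S}. Poly_Mapping.single j 1)"

definition toric_hom :: "nat \<Rightarrow> (nat \<Rightarrow> 'v) \<Rightarrow> (nat \<Rightarrow> 'v set) \<Rightarrow> ('k::field) mpoly \<Rightarrow> 'k mpoly" where
  "toric_hom n v S =
     algebra_hom (\<lambda>i. Poly_Mapping.single (rho n v (S i)) 1
                      * Poly_Mapping.single (Poly_Mapping.single 0 1) 1)"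

definition toric_ideal :: "nat \<Rightarrow> (nat \<Rightarrow> 'v) \<Rightarrow> nat \<Rightarrow> (nat \<Rightarrow> 'v set) \<Rightarrow> ('k::field) mpoly set" where
  "toric_ideal n v m S = {p \<in> poly_ring m. toric_hom n v S p = 0}"

text \<open>\<open>S 1, \<dots>, S m\<close> lists the stable sets in decreasing order. The library order \<open><\<close> on
  exponent vectors is the lexicographic one in which variables of smaller index are larger
  (\<open>a < b\<close> iff \<open>a\<close> is smaller than \<open>b\<close> at the first index where they differ), so that
  $t_1 > \cdots > t_n$ here.\<close>

definition lex_indexing ::
    "'v set \<Rightarrow> 'v set set \<Rightarrow> nat \<Rightarrow> (nat \<Rightarrow> 'v) \<Rightarrow> nat \<Rightarrow> (nat \<Rightarrow> 'v set) \<Rightarrow> bool" where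
  "lex_indexing V E n v m S \<longleftrightarrow>
     bij_betw S {1..m} (stable_sets V E) \<and>
     (\<forall>i\<in>{1..m}. \<forall>j\<in>{1..m}. i < j \<longrightarrow> rho n v (S i) > rho n v (S j))"

end

theory Submission
  imports Defs
begin

text \<open>
  Say that a stable set \<open>A\<close> dominates \<open>B\<close> when every vertex of \<open>B - A\<close> has an earlier neighbour
  in \<open>A\<close>. The claim is that the initial ideal is generated by the monomials \<open>x\<^sub>k x\<^sub>l\<close>, \<open>k < l\<close>, such
  that \<open>S k\<close> does not dominate \<open>S l\<close>.

  Each such \<open>x\<^sub>k x\<^sub>l\<close> is an initial monomial (\<open>undominated_pair_initial\<close>). The graph induced on
  \<open>S k \<union> S l\<close> is bipartite, so greedy colouring along the perfect ordering uses at most two colours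
  on it. Let \<open>A'\<close> be the first colour class, and let \<open>B'\<close> be the second one together with
  \<open>S k \<inter> S l\<close>. Both are stable, together they cover each vertex as often as \<open>S k\<close> and \<open>S l\<close> do,
  and \<open>A'\<close> dominates \<open>S k \<union> S l\<close> (\<open>greedy_exchange\<close>). A dominating set is never lexicographically
  smaller than a stable set that it dominates, and \<open>A'\<close> differs from \<open>S k\<close> because it dominates
  \<open>S l\<close>. So the variable of \<open>A'\<close> lies below \<open>x\<^sub>k\<close>, hence below \<open>x\<^sub>l\<close>, and the binomial
  \<open>x\<^sub>k x\<^sub>l - x\<^bsub>A'\<^esub> x\<^bsub>B'\<^esub>\<close> of the toric ideal has initial monomial \<open>x\<^sub>k x\<^sub>l\<close>.

  Conversely, let \<open>x\<^sup>a\<close> be the initial monomial of an element of the toric ideal. Cancellation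
  forces another monomial \<open>x\<^sup>b\<close> of that element to have the same image in the target ring
  (\<open>toric_fibre\<close>), and \<open>x\<^sup>b\<close> is smaller than \<open>x\<^sup>a\<close>. At the first index \<open>i\<close> where \<open>a\<close> and \<open>b\<close>
  differ, \<open>a\<close> has the smaller exponent. Let \<open>x\<^sub>k\<close> be the first variable after \<open>x\<^sub>i\<close> that divides \<open>x\<^sup>a\<close>. As \<open>S i\<close>
  is lexicographically larger than \<open>S k\<close>, some vertex \<open>u\<close> of \<open>S i - S k\<close> has no earlier neighbour in
  \<open>S k\<close>. Counting the occurrences of \<open>u\<close> in both monomials gives a factor \<open>x\<^sub>l\<close> of \<open>x\<^sup>a\<close> with
  \<open>l > k\<close> and \<open>u \<in> S l\<close>, so \<open>S k\<close> does not dominate \<open>S l\<close>, and the generator \<open>x\<^sub>k x\<^sub>l\<close> divides \<open>x\<^sup>a\<close>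
  (\<open>revlex_greater_in_fibre_has_undominated_pair\<close>).
\<close>

section \<open>Domination and greedy colouring\<close>

lemma lookup_rho:
  "Poly_Mapping.lookup (rho n v A) j = of_bool (j \<in> {1..n} \<and> v j \<in> A)"
proof -
  have "Poly_Mapping.lookup (rho n v A) j = (\<Sum>i\<in>{i\<in>{1..n}. v i \<in> A}. 1 when i = j)"
    by (simp add: rho_def lookup_sum lookup_single)
  also have "\<dots> = of_bool (j \<in> {1..n} \<and> v j \<in> A)"
    by (auto simp: when_def sum.delta)
  finally show ?thesis .
qed

text \<open>Every vertex of \<open>B - A\<close> has a neighbour in \<open>A\<close> that precedes it in the ordering \<open>v 1, \<dots>, v n\<close>.
  Neither set is required to be stable.\<close>

definition dominates :: "nat \<Rightarrow> (nat \<Rightarrow> 'v) \<Rightarrow> 'v set set \<Rightarrow> 'v set \<Rightarrow> 'v set \<Rightarrow> bool" where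
  "dominates n v E A B \<longleftrightarrow>
     (\<forall>j\<in>{1..n}. v j \<in> B - A \<longrightarrow> (\<exists>i\<in>{1..<j}. v i \<in> A \<and> {v i, v j} \<in> E))"

text \<open>The witness is the first vertex on which \<open>A\<close> and \<open>B\<close> differ: an earlier neighbour in \<open>A\<close> would
  also lie in the stable set \<open>B\<close>.\<close>

lemma lex_smaller_imp_undominated_vertex:
  assumes inj: "inj_on v {1..n}" and B: "B \<in> stable_sets V E"
    and less: "rho n v A < rho n v B"
  obtains j where "j \<in> {1..n}" "v j \<in> B - A"
    "\<And>i. i \<in> {1..<j} \<Longrightarrow> v i \<in> A \<Longrightarrow> {v i, v j} \<notin> E"
proof -
  obtain j where j: "Poly_Mapping.lookup (rho n v A) j < Poly_Mapping.lookup (rho n v B) j"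
    and eq: "\<And>i. i < j \<Longrightarrow> Poly_Mapping.lookup (rho n v A) i = Poly_Mapping.lookup (rho n v B) i"
    using less by (auto simp: less_poly_mapping.rep_eq less_fun_def)
  have jn: "j \<in> {1..n}" "v j \<in> B - A"
    using j by (auto simp: lookup_rho of_bool_def split: if_splits)
  have "{v i, v j} \<notin> E" if "i \<in> {1..<j}" "v i \<in> A" for i
  proof -
    have "v i \<in> B"
      using eq[of i] that jn by (cases "v i \<in> B") (simp_all add: lookup_rho)
    moreover have "v i \<noteq> v j"
      using inj_on_eq_iff[OF inj, of i j] that jn by simp
    ultimately show ?thesis
      using B jn by (simp add: stable_sets_def)
  qed
  with jn that show ?thesis by blast
qed

lemma dominates_not_lex_smaller:
  assumes "inj_on v {1..n}" "B \<in> stable_sets V E" "dominates n v E A B"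
  shows "\<not> rho n v A < rho n v B"
  using lex_smaller_imp_undominated_vertex[OF assms(1,2)] assms(3)
  unfolding dominates_def by metis

text \<open>Here \<open>R\<close> stands for a relation that holds from earlier to later entries of the list, and \<open>F\<close> may be any set of edges. The last
  conjunct is the greedy property of the first colour class: a vertex outside it was refused colour 1
  because of an earlier neighbour.\<close>

lemma greedy_coloring_invariant:
  fixes F :: "'v set set"
  assumes "distinct ws" "sorted_wrt R ws"
  defines "c \<equiv> greedy_coloring F ws"
  shows "(\<forall>w. w \<notin> set ws \<longrightarrow> c w = 0) \<and> (\<forall>w\<in>set ws. c w \<ge> 1) \<and>
     (\<forall>u\<in>set ws. \<forall>w\<in>set ws. u \<noteq> w \<longrightarrow> {u, w} \<in> F \<longrightarrow> c u \<noteq> c w) \<and>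
     (\<forall>w\<in>set ws. c w \<noteq> 1 \<longrightarrow> (\<exists>u\<in>set ws. R u w \<and> {u, w} \<in> F \<and> c u = 1))"
  using assms(1,2) unfolding c_def
proof (induction ws rule: rev_induct)
  case Nil
  then show ?case by (simp add: greedy_coloring_def)
next
  case (snoc x xs)
  define c where "c = greedy_coloring F xs"
  define P where "P k \<longleftrightarrow> k \<ge> 1 \<and> (\<forall>u. {u, x} \<in> F \<longrightarrow> c u \<noteq> k)" for k
  define k where "k = (LEAST k. P k)"
  have c': "greedy_coloring F (xs @ [x]) = c(x := k)"
    by (simp add: greedy_coloring_def c_def k_def P_def greedy_step_def)
  have x: "x \<notin> set xs" and R: "\<forall>u\<in>set xs. R u x" "distinct xs" "sorted_wrt R xs"
    using snoc.prems by (auto simp: sorted_wrt_append)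
  note IH = snoc.IH[OF R(2,3), folded c_def]
  \<comment> \<open>Only finitely many colours are in use, so the least unused one exists.\<close>
  have "P (Suc (Max (insert 0 (c ` set xs))))"
    unfolding P_def
  proof (intro conjI allI impI)
    fix u
    have "c u \<le> Max (insert 0 (c ` set xs))"
      using IH by (cases "u \<in> set xs") auto
    then show "c u \<noteq> Suc (Max (insert 0 (c ` set xs)))" by simp
  qed simp
  then have Pk: "P k" unfolding k_def by (rule LeastI)
  have first: "\<exists>u\<in>set xs. {u, x} \<in> F \<and> c u = 1" if "k \<noteq> 1"
  proof -
    have "\<not> P 1"
      using that \<open>P k\<close> Least_le[of P 1, folded k_def] by (auto simp: P_def)
    then obtain u where "{u, x} \<in> F" "c u = 1" by (auto simp: P_def)
    moreover from this IH have "u \<in> set xs" by force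
    ultimately show ?thesis by blast
  qed
  have new: "c u \<noteq> k" if "{u, x} \<in> F \<or> {x, u} \<in> F" for u
    using Pk that by (auto simp: P_def insert_commute)
  have proper: "\<forall>u\<in>set (xs @ [x]). \<forall>w\<in>set (xs @ [x]). u \<noteq> w \<longrightarrow> {u, w} \<in> F \<longrightarrow> (c(x := k)) u \<noteq> (c(x := k)) w"
    using IH new by (auto dest: not_sym)
  have k1: "k \<ge> 1" using Pk by (simp add: P_def)
  have "\<exists>u\<in>set (xs @ [x]). R u w \<and> {u, w} \<in> F \<and> (c(x := k)) u = 1"
    if w: "w \<in> set (xs @ [x])" "(c(x := k)) w \<noteq> 1" for w
  proof -
    obtain u where "u \<in> set xs" "R u w" "{u, w} \<in> F" "c u = 1"
      using w IH first R(1) by (cases "w = x") auto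
    then show ?thesis using x by (intro bexI[of _ u]) auto
  qed
  moreover have "\<forall>w. w \<notin> set (xs @ [x]) \<longrightarrow> (c(x := k)) w = 0" using IH by simp
  moreover have "\<forall>w\<in>set (xs @ [x]). (c(x := k)) w \<ge> 1" using IH k1 by simp
  ultimately show ?case unfolding c' using proper by blast
qed

text \<open>The perfect ordering enters the argument only here, through the bipartite subgraph induced on
  \<open>A \<union> B\<close>.\<close>

lemma greedy_exchange:
  assumes G: "simple_graph V E" and perf: "perfect_ordering V E n v"
    and A: "A \<in> stable_sets V E" and B: "B \<in> stable_sets V E"
  obtains A' B' where "A' \<in> stable_sets V E" "B' \<in> stable_sets V E"
    "dominates n v E A' (A \<union> B)" "rho n v A' + rho n v B' = rho n v A + rho n v B"
proof -
  define W where "W = A \<union> B"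
  define F where "F = induced_edges W E"
  define ws where "ws = filter (\<lambda>w. w \<in> W) (map v [1..<Suc n])"
  define c where "c = greedy_coloring F ws"
  define R where "R a b \<longleftrightarrow> (\<exists>i j. 1 \<le> i \<and> i < j \<and> j \<le> n \<and> a = v i \<and> b = v j)" for a b
  have WV: "W \<subseteq> V" using A B by (auto simp: W_def stable_sets_def)
  have bij: "bij_betw v {1..n} V" and inj: "inj_on v {1..n}"
    using perf by (auto simp: perfect_ordering_def bij_betw_def)
  have F: "{a, b} \<in> F \<longleftrightarrow> a \<in> W \<and> b \<in> W \<and> {a, b} \<in> E" for a b
    by (auto simp: F_def induced_edges_def)
  have range: "set [1..<Suc n] = {1..n}" by auto
  have set_ws: "set ws = W"
    using WV bij unfolding ws_def set_filter set_map range by (auto simp: bij_betw_def)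
  have "distinct ws"
    unfolding ws_def by (intro distinct_filter) (simp only: distinct_map range inj distinct_upt)
  moreover have "sorted_wrt R ws"
  proof -
    have "sorted_wrt (\<lambda>i j. R (v i) (v j)) [1..<Suc n]"
    proof (rule sorted_wrt_mono_rel[OF _ sorted_wrt_upt])
      fix i j assume "i \<in> set [1..<Suc n]" "j \<in> set [1..<Suc n]" "i < j"
      then show "R (v i) (v j)"
        unfolding R_def range by (intro exI[of _ i] exI[of _ j]) auto
    qed
    then show ?thesis
      unfolding ws_def by (intro sorted_wrt_filter) (simp only: sorted_wrt_map)
  qed
  ultimately have
    pos: "\<And>w. w \<in> W \<Longrightarrow> c w \<ge> 1" and
    proper: "\<And>a b. a \<in> W \<Longrightarrow> b \<in> W \<Longrightarrow> a \<noteq> b \<Longrightarrow> {a, b} \<in> E \<Longrightarrow> c a \<noteq> c b" and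
    greedy: "\<And>w. w \<in> W \<Longrightarrow> c w \<noteq> 1 \<Longrightarrow> \<exists>u\<in>W. R u w \<and> {u, w} \<in> E \<and> c u = 1"
    using greedy_coloring_invariant[of ws R F] unfolding set_ws c_def[symmetric] F by blast+

  have "chromatic_number W F \<le> 2"
    unfolding chromatic_number_def
  proof (intro Least_le exI conjI)
    show "proper_coloring W F (\<lambda>w. if w \<in> A then 1 else 2)"
      unfolding proper_coloring_def
    proof (intro ballI impI)
      fix a b assume ab: "a \<in> W" "b \<in> W" "{a, b} \<in> F"
      have "a \<noteq> b" using ab G by (auto simp: F simple_graph_def)
      then show "(if a \<in> A then 1 else 2::nat) \<noteq> (if b \<in> A then 1 else 2)"
        using ab A B by (auto simp: F W_def stable_sets_def)
    qed
  qed auto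
  then have card2: "card (c ` W) \<le> 2"
    using perf WV unfolding perfect_ordering_def c_def F_def ws_def by auto
  have fin: "finite W" using WV G by (auto simp: simple_graph_def intro: finite_subset)

  define A' where "A' = {w \<in> W. c w = 1}"
  define B' where "B' = (W - A') \<union> (A \<inter> B)"
  \<comment> \<open>A common vertex of two stable sets is isolated in their union, hence gets colour 1.\<close>
  have AB: "{a, b} \<notin> E" if "a \<in> A \<inter> B" "b \<in> W" for a b
  proof (cases "a = b")
    case True
    then show ?thesis using G by (auto simp: simple_graph_def)
  next
    case False
    then show ?thesis using that A B by (auto simp: W_def stable_sets_def)
  qed
  have sub: "A \<inter> B \<subseteq> A'"
  proof
    fix x assume x: "x \<in> A \<inter> B"
    have "c x = 1"
      using greedy[of x] AB[OF x] x by (auto simp: W_def insert_commute)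
    then show "x \<in> A'" using x by (auto simp: A'_def W_def)
  qed
  have "A' \<in> stable_sets V E"
    using WV proper by (fastforce simp: A'_def stable_sets_def)
  moreover have "B' \<in> stable_sets V E"
  proof -
    \<comment> \<open>Colour 1 occurs as soon as another colour does, which leaves one further colour.\<close>
    have same: "c a = c b" if ab: "a \<in> W - A'" "b \<in> W - A'" for a b
    proof (rule ccontr)
      assume ne: "c a \<noteq> c b"
      obtain u where "u \<in> W" "c u = 1" using greedy[of a] ab by (auto simp: A'_def)
      then have "1 \<in> c ` W" by (metis image_eqI)
      then have "{1, c a, c b} \<subseteq> c ` W" using ab by blast
      then have "card {1, c a, c b} \<le> card (c ` W)" using fin by (intro card_mono) auto
      moreover have "card {1, c a, c b} = 3" using ab ne by (auto simp: A'_def)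
      ultimately show False using card2 by simp
    qed
    have "{a, b} \<notin> E" if ab: "a \<in> B'" "b \<in> B'" "a \<noteq> b" for a b
    proof -
      consider "a \<in> A \<inter> B" | "b \<in> A \<inter> B" | "a \<in> W - A'" "b \<in> W - A'"
        using ab by (auto simp: B'_def)
      then show ?thesis
      proof cases
        case 1
        then show ?thesis using AB[of a b] ab by (auto simp: B'_def W_def)
      next
        case 2
        then show ?thesis using AB[of b a] ab by (auto simp: B'_def W_def insert_commute)
      next
        case 3
        then show ?thesis using proper[of a b] same[of a b] ab by auto
      qed
    qed
    then show ?thesis using WV by (auto simp: stable_sets_def B'_def W_def)
  qed
  moreover have "dominates n v E A' (A \<union> B)"
    unfolding dominates_def
  proof (intro ballI impI)
    fix j assume j: "j \<in> {1..n}" "v j \<in> A \<union> B - A'"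
    then obtain u where u: "u \<in> W" "R u (v j)" "{u, v j} \<in> E" "c u = 1"
      using greedy[of "v j"] by (auto simp: A'_def W_def)
    then obtain i j' where i: "1 \<le> i" "i < j'" "j' \<le> n" "u = v i" "v j = v j'"
      by (auto simp: R_def)
    have "j = j'" by (rule inj_onD[OF inj i(5)]) (use i(1-3) j(1) in auto)
    then show "\<exists>i\<in>{1..<j}. v i \<in> A' \<and> {v i, v j} \<in> E"
      using u i(1-4) by (intro bexI[of _ i]) (simp_all add: A'_def)
  qed
  moreover have "rho n v A' + rho n v B' = rho n v A + rho n v B"
  proof (rule poly_mapping_eqI)
    fix j
    have "of_bool (w \<in> A') + of_bool (w \<in> B') = (of_bool (w \<in> A) + of_bool (w \<in> B) :: nat)" for w
    proof -
      have "w \<in> A \<and> w \<in> B \<longrightarrow> w \<in> A'" "w \<in> A' \<longrightarrow> w \<in> A \<or> w \<in> B"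
        "w \<in> B' \<longleftrightarrow> (w \<in> A \<or> w \<in> B) \<and> w \<notin> A' \<or> w \<in> A \<and> w \<in> B"
        using sub by (auto simp: A'_def B'_def W_def)
      then show ?thesis
        by (cases "w \<in> A"; cases "w \<in> B"; cases "w \<in> A'") simp_all
    qed
    from this[of "v j"] show "Poly_Mapping.lookup (rho n v A' + rho n v B') j =
        Poly_Mapping.lookup (rho n v A + rho n v B) j"
      by (cases "j \<in> {1..n}") (simp_all only: lookup_add lookup_rho simp_thms)
  qed
  ultimately show ?thesis using that by blast
qed

section \<open>Polynomial rings and ideals\<close>

lemma poly_ring_mult:
  assumes "p \<in> poly_ring m" "q \<in> poly_ring m"
  shows "p * q \<in> poly_ring m"
proof -
  have "Poly_Mapping.keys c \<subseteq> {1..m}" if c: "c \<in> Poly_Mapping.keys (p * q)" for c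
  proof -
    obtain a b where "c = a + b" "a \<in> Poly_Mapping.keys p" "b \<in> Poly_Mapping.keys q"
      using subsetD[OF keys_mult c] by blast
    then show ?thesis
      using assms Poly_Mapping.keys_add[of a b] unfolding poly_ring_def by blast
  qed
  then show ?thesis by (simp add: poly_ring_def)
qed

lemma poly_ring_sum:
  assumes "\<And>i. i \<in> T \<Longrightarrow> f i \<in> poly_ring m"
  shows "(\<Sum>i\<in>T. f i) \<in> poly_ring m"
  using keys_sum[of f T] assms by (fastforce simp: poly_ring_def)

lemma poly_ring_single:
  "Poly_Mapping.keys a \<subseteq> {1..m} \<Longrightarrow> Poly_Mapping.single a x \<in> poly_ring m"
  by (auto simp: poly_ring_def)

text \<open>The elements of \<open>B\<close> that share a chosen divisor in \<open>C\<close> have to be collected, since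
  \<open>ideal_generated\<close> allows one coefficient per generator.\<close>

lemma ideal_generated_subset:
  assumes mult: "\<And>b. b \<in> B \<Longrightarrow> \<exists>s\<in>poly_ring m. \<exists>g\<in>C. b = s * g"
  shows "ideal_generated m B \<subseteq> ideal_generated m C"
proof
  fix p assume "p \<in> ideal_generated m B"
  then obtain T r where T: "finite T" "T \<subseteq> B" "\<forall>b\<in>T. r b \<in> poly_ring m"
    and p: "p = (\<Sum>b\<in>T. r b * b)"
    by (auto simp: ideal_generated_def)
  from mult obtain s g where sg: "\<And>b. b \<in> B \<Longrightarrow> s b \<in> poly_ring m"
    "\<And>b. b \<in> B \<Longrightarrow> g b \<in> C" "\<And>b. b \<in> B \<Longrightarrow> b = s b * g b"
    by metis
  have "p = (\<Sum>b\<in>T. r b * s b * g b)"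
    unfolding p using T sg by (intro sum.cong refl) (metis mult.assoc subsetD)
  also have "\<dots> = (\<Sum>h\<in>g ` T. \<Sum>b\<in>{b\<in>T. g b = h}. r b * s b * g b)"
    by (rule sum.image_gen[OF T(1)])
  also have "\<dots> = (\<Sum>h\<in>g ` T. (\<Sum>b\<in>{b\<in>T. g b = h}. r b * s b) * h)"
    unfolding sum_distrib_right by (intro sum.cong refl) simp
  finally have "p = (\<Sum>h\<in>g ` T. (\<Sum>b\<in>{b\<in>T. g b = h}. r b * s b) * h)" .
  moreover have "\<forall>h\<in>g ` T. (\<Sum>b\<in>{b\<in>T. g b = h}. r b * s b) \<in> poly_ring m"
    using T sg by (intro ballI poly_ring_sum poly_ring_mult) auto
  ultimately show "p \<in> ideal_generated m C"
    unfolding ideal_generated_def using T sg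
    by (intro CollectI exI[of _ "g ` T"] exI[of _ "\<lambda>h. \<Sum>b\<in>{b\<in>T. g b = h}. r b * s b"]) auto
qed

section \<open>The toric homomorphism on monomials\<close>

text \<open>The exponent vector of the image of the monomial with exponent vector \<open>a\<close>. Its entry at 0 is the
  degree of \<open>a\<close> (the exponent of $s$). The products \<open>a\<^sub>i (rho (S i) + e\<^sub>0)\<close> are written as iterated sums,
  which match the powers of the images of the variables.\<close>

definition toric_exponent :: "nat \<Rightarrow> (nat \<Rightarrow> 'v) \<Rightarrow> (nat \<Rightarrow> 'v set) \<Rightarrow> monomial \<Rightarrow> monomial" where
  "toric_exponent n v S a =
     (\<Sum>i\<in>Poly_Mapping.keys a. \<Sum>_<Poly_Mapping.lookup a i. rho n v (S i) + Poly_Mapping.single 0 1)"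

lemma single_one_power:
  "Poly_Mapping.single (g :: monomial) (1::'k::field) ^ e = Poly_Mapping.single (\<Sum>_<e. g) 1"
  by (induction e) (simp_all add: Poly_Mapping.mult_single add.commute del: sum_constant)

lemma prod_single_one:
  "(\<Prod>i\<in>T. Poly_Mapping.single (g i :: monomial) (1::'k::field)) = Poly_Mapping.single (\<Sum>i\<in>T. g i) 1"
  by (induction T rule: infinite_finite_induct) (simp_all add: Poly_Mapping.mult_single)

lemma toric_hom_eq_sum:
  fixes p :: "('k::field) mpoly"
  shows "toric_hom n v S p =
    (\<Sum>a\<in>Poly_Mapping.keys p. Poly_Mapping.single (toric_exponent n v S a) (Poly_Mapping.lookup p a))"
  unfolding toric_hom_def algebra_hom_def toric_exponent_def
  by (simp add: Poly_Mapping.mult_single single_one_power prod_single_one del: sum_constant)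

lemma lookup_toric_exponent:
  assumes "Poly_Mapping.keys a \<subseteq> {1..m}"
  shows "Poly_Mapping.lookup (toric_exponent n v S a) j =
    (\<Sum>i\<in>{1..m}. Poly_Mapping.lookup a i * of_bool (j = 0 \<or> j \<in> {1..n} \<and> v j \<in> S i))"
proof -
  have "Poly_Mapping.lookup (toric_exponent n v S a) j =
    (\<Sum>i\<in>Poly_Mapping.keys a. Poly_Mapping.lookup a i * of_bool (j = 0 \<or> j \<in> {1..n} \<and> v j \<in> S i))"
    unfolding toric_exponent_def lookup_sum
    by (intro sum.cong refl) (auto simp: lookup_add lookup_rho lookup_single when_def)
  also have "\<dots> = (\<Sum>i\<in>{1..m}. Poly_Mapping.lookup a i * of_bool (j = 0 \<or> j \<in> {1..n} \<and> v j \<in> S i))"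
    using assms by (intro sum.mono_neutral_left) (auto simp: in_keys_iff)
  finally show ?thesis .
qed

lemma monomial_degree_eq_sum:
  assumes "Poly_Mapping.keys a \<subseteq> {1..m}"
  shows "monomial_degree a = (\<Sum>i\<in>{1..m}. Poly_Mapping.lookup a i)"
  unfolding monomial_degree_def
  using assms by (intro sum.mono_neutral_left) (auto simp: in_keys_iff)

lemma pair_keys:
  assumes "k \<in> {1..m}" "l \<in> {1..m}"
  shows "Poly_Mapping.keys (Poly_Mapping.single k (1::nat) + Poly_Mapping.single l 1) \<subseteq> {1..m}"
  using assms keys_add[of "Poly_Mapping.single k (1::nat)" "Poly_Mapping.single l 1"] by auto

lemma toric_exponent_pair:
  assumes "k \<in> {1..m}" "l \<in> {1..m}"
  shows "toric_exponent n v S (Poly_Mapping.single k 1 + Poly_Mapping.single l 1) =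
     rho n v (S k) + rho n v (S l) + Poly_Mapping.single 0 2"
proof (rule poly_mapping_eqI)
  fix j
  note lookup_toric_exponent[OF pair_keys[OF assms], of n v S j]
  also have "(\<Sum>i\<in>{1..m}. Poly_Mapping.lookup (Poly_Mapping.single k 1 + Poly_Mapping.single l 1) i
      * of_bool (j = 0 \<or> j \<in> {1..n} \<and> v j \<in> S i)) =
    (\<Sum>i\<in>{1..m}. if k = i then of_bool (j = 0 \<or> j \<in> {1..n} \<and> v j \<in> S i) else 0) +
    (\<Sum>i\<in>{1..m}. if l = i then of_bool (j = 0 \<or> j \<in> {1..n} \<and> v j \<in> S i) else 0 :: nat)"
    unfolding sum.distrib[symmetric]
    by (intro sum.cong refl) (simp add: lookup_add lookup_single when_def)
  also have "\<dots> = Poly_Mapping.lookup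
      (rho n v (S k) + rho n v (S l) + Poly_Mapping.single 0 2) j"
    using assms by (auto simp: lookup_add lookup_rho lookup_single when_def simp del: single_numeral)
  finally show "Poly_Mapping.lookup
      (toric_exponent n v S (Poly_Mapping.single k 1 + Poly_Mapping.single l 1)) j = \<dots>" .
qed

text \<open>The coefficients over each exponent vector of the target cancel, so no monomial of an element of
  the kernel is alone in its fibre.\<close>

lemma toric_fibre:
  fixes p :: "('k::field) mpoly"
  assumes "toric_hom n v S p = 0" "a \<in> Poly_Mapping.keys p"
  obtains b where "b \<in> Poly_Mapping.keys p" "b \<noteq> a" "toric_exponent n v S b = toric_exponent n v S a"
proof (rule ccontr)
  note witness = that
  assume 1: "\<not> thesis"
  have only: "toric_exponent n v S b = toric_exponent n v S a \<longleftrightarrow> b = a"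
    if "b \<in> Poly_Mapping.keys p" for b
    using that(1) 1 witness by blast
  have "0 = Poly_Mapping.lookup (toric_hom n v S p) (toric_exponent n v S a)"
    using assms by simp
  also have "\<dots> = (\<Sum>b\<in>Poly_Mapping.keys p. if b = a then Poly_Mapping.lookup p b else 0)"
    unfolding toric_hom_eq_sum lookup_sum
    by (intro sum.cong refl) (simp add: lookup_single when_def only)
  also have "\<dots> = Poly_Mapping.lookup p a"
    using assms(2) by (simp add: sum.delta)
  finally show False using assms(2) by (simp add: in_keys_iff)
qed

section \<open>Quadratic initial monomials\<close>

text \<open>Lexicographically larger stable sets have smaller indices, hence smaller variables.\<close>

lemma lex_indexing_less:
  assumes "lex_indexing V E n v m S" "p \<in> {1..m}" "k \<in> {1..m}" "p \<noteq> k"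
    and "\<not> rho n v (S p) < rho n v (S k)"
  shows "p < k"
  using assms unfolding lex_indexing_def by (meson linorder_neqE_nat)

lemma pair_degree:
  assumes "k \<in> {1..m}" "l \<in> {1..m}"
  shows "monomial_degree (Poly_Mapping.single k 1 + Poly_Mapping.single l 1) = 2"
  using assms unfolding monomial_degree_eq_sum[OF pair_keys[OF assms]] lookup_add sum.distrib
  by (simp add: lookup_single when_def)

lemma undominated_pair_initial:
  assumes G: "simple_graph V E" and perf: "perfect_ordering V E n v"
    and lex: "lex_indexing V E n v m S"
    and kl: "k \<in> {1..m}" "l \<in> {1..m}" "k < l" and nd: "\<not> dominates n v E (S k) (S l)"
  shows "\<exists>p\<in>(toric_ideal n v m S :: ('k::field) mpoly set). p \<noteq> 0 \<and>
    is_initial_monomial revlex_greater p (Poly_Mapping.single k 1 + Poly_Mapping.single l 1)"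
proof -
  have bij: "bij_betw S {1..m} (stable_sets V E)" using lex by (simp add: lex_indexing_def)
  have stable: "S i \<in> stable_sets V E" if "i \<in> {1..m}" for i
    using bij that by (auto simp: bij_betw_def)
  have inj: "inj_on v {1..n}" using perf by (auto simp: perfect_ordering_def bij_betw_def)
  obtain A' B' where AB: "A' \<in> stable_sets V E" "B' \<in> stable_sets V E"
    "dominates n v E A' (S k \<union> S l)" "rho n v A' + rho n v B' = rho n v (S k) + rho n v (S l)"
    using greedy_exchange[OF G perf stable[OF kl(1)] stable[OF kl(2)]] .
  obtain p q where pq: "p \<in> {1..m}" "q \<in> {1..m}" "S p = A'" "S q = B'"
    using AB bij by (metis bij_betw_imp_surj_on imageE)
  have "p < k"
  proof (rule lex_indexing_less[OF lex pq(1) kl(1)])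
    have dom: "dominates n v E (S p) (S k)" "dominates n v E (S p) (S l)"
      using AB(3) pq(3) by (auto simp: dominates_def)
    then show "p \<noteq> k" using nd by auto
    show "\<not> rho n v (S p) < rho n v (S k)"
      using dominates_not_lex_smaller[OF inj stable[OF kl(1)] dom(1)] .
  qed
  define a where "a = Poly_Mapping.single k (1::nat) + Poly_Mapping.single l 1"
  define b where "b = Poly_Mapping.single p (1::nat) + Poly_Mapping.single q 1"
  have ne: "a \<noteq> b"
  proof
    assume "a = b"
    then have "Poly_Mapping.lookup a p = Poly_Mapping.lookup b p" by simp
    then show False using \<open>p < k\<close> kl by (simp add: a_def b_def lookup_add lookup_single when_def)
  qed
  have gr: "revlex_greater a b"
    unfolding revlex_greater_def
    \<comment> \<open>Both variables of \<open>a\<close> come after \<open>p\<close>, so the monomials first differ at the least index in \<open>b\<close>.\<close>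
  proof (intro disjI2 conjI exI[of _ "min p q"] allI impI)
    show "monomial_degree a = monomial_degree b"
      by (simp only: a_def b_def pair_degree[OF kl(1,2)] pair_degree[OF pq(1,2)])
    show "Poly_Mapping.lookup a (min p q) < Poly_Mapping.lookup b (min p q)"
      using \<open>p < k\<close> kl by (cases "p \<le> q") (simp_all add: a_def b_def lookup_add lookup_single when_def)
    show "Poly_Mapping.lookup a j = Poly_Mapping.lookup b j" if "j < min p q" for j
      using that \<open>p < k\<close> kl by (simp add: a_def b_def lookup_add lookup_single when_def)
  qed
  have exps: "toric_exponent n v S a = toric_exponent n v S b"
    unfolding a_def b_def toric_exponent_pair[OF kl(1,2)] toric_exponent_pair[OF pq(1,2)]
    using AB(4) pq by simp
  define f where "f = Poly_Mapping.single a (1::'k) - Poly_Mapping.single b 1"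
  have f: "Poly_Mapping.lookup f c = (if c = a then 1 else if c = b then -1 else 0)" for c
    using ne by (simp add: f_def lookup_minus lookup_single when_def)
  have keys: "Poly_Mapping.keys f = {a, b}"
    by (auto simp: in_keys_iff f split: if_splits)
  have "toric_hom n v S f = 0"
    unfolding toric_hom_eq_sum keys using ne exps
    by (simp add: f flip: single_add)
  moreover have "f \<in> poly_ring m"
    using pair_keys[OF kl(1,2)] pair_keys[OF pq(1,2)] by (simp add: poly_ring_def keys a_def b_def)
  ultimately have "f \<in> toric_ideal n v m S" by (simp add: toric_ideal_def)
  moreover have "f \<noteq> 0" using keys by auto
  moreover have "is_initial_monomial revlex_greater f a"
    using gr by (auto simp: is_initial_monomial_def keys)
  ultimately show ?thesis unfolding a_def by blast
qed

text \<open>A monomial that is not the smallest one in its fibre is divisible by \<open>x\<^sub>k x\<^sub>l\<close> for some \<open>k < l\<close>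
  such that \<open>S k\<close> does not dominate \<open>S l\<close>.\<close>

lemma revlex_greater_in_fibre_has_undominated_pair:
  assumes inj: "inj_on v {1..n}" and lex: "lex_indexing V E n v m S"
    and a: "Poly_Mapping.keys a \<subseteq> {1..m}" and b: "Poly_Mapping.keys b \<subseteq> {1..m}"
    and fibre: "toric_exponent n v S a = toric_exponent n v S b"
    and gr: "revlex_greater a b"
  obtains k l where "k \<in> Poly_Mapping.keys a" "l \<in> Poly_Mapping.keys a" "k < l"
    "\<not> dominates n v E (S k) (S l)"
proof -
  define la where "la = Poly_Mapping.lookup a"
  define lb where "lb = Poly_Mapping.lookup b"
  have count: "(\<Sum>i\<in>{1..m}. la i * of_bool (j = 0 \<or> j \<in> {1..n} \<and> v j \<in> S i)) =
      (\<Sum>i\<in>{1..m}. lb i * of_bool (j = 0 \<or> j \<in> {1..n} \<and> v j \<in> S i))" for j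
    using lookup_toric_exponent[OF a, of n v S j] lookup_toric_exponent[OF b, of n v S j] fibre
    by (simp add: la_def lb_def)
  have "monomial_degree a = monomial_degree b"
    using count[of 0] by (simp add: monomial_degree_eq_sum[OF a] monomial_degree_eq_sum[OF b] la_def lb_def)
  then obtain i where i: "la i < lb i" and eq: "\<And>j. j < i \<Longrightarrow> la j = lb j"
    using gr by (auto simp: revlex_greater_def la_def lb_def)
  have "i \<in> Poly_Mapping.keys b" using i by (simp add: lb_def in_keys_iff)
  then have im: "i \<in> {1..m}" using b by blast
  \<comment> \<open>If both monomials have equally many factors with property \<open>P\<close>, and \<open>x\<^sub>i\<close> has it, then \<open>a\<close> makes up
    for its deficit at \<open>i\<close> by a later factor. This is used with \<open>P\<close> true and with \<open>P\<close> saying that the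
    set contains a given vertex.\<close>
  have later: "\<exists>l\<in>Poly_Mapping.keys a. i < l \<and> P l"
    if P: "P i" and sums: "(\<Sum>i\<in>{1..m}. la i * of_bool (P i)) = (\<Sum>i\<in>{1..m}. lb i * of_bool (P i))" for P
  proof (rule ccontr)
    assume none: "\<not> ?thesis"
    have "la j * of_bool (P j) \<le> lb j * of_bool (P j)" for j
    proof (cases "i < j")
      case True
      then have "la j = 0 \<or> \<not> P j" using none by (auto simp: la_def in_keys_iff)
      then show ?thesis by auto
    next
      case False
      then show ?thesis using i eq[of j] by (cases "j = i") auto
    qed
    moreover have "la i * of_bool (P i) < lb i * of_bool (P i)" using i P by simp
    ultimately have "(\<Sum>i\<in>{1..m}. la i * of_bool (P i)) < (\<Sum>i\<in>{1..m}. lb i * of_bool (P i))"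
      using im by (intro sum_strict_mono_ex1) auto
    then show False using sums by simp
  qed
  define k where "k = (LEAST l. l \<in> Poly_Mapping.keys a \<and> i < l)"
  have "\<exists>l. l \<in> Poly_Mapping.keys a \<and> i < l"
    using later[of "\<lambda>_. True"] count[of 0] by auto
  then have k: "k \<in> Poly_Mapping.keys a" "i < k"
    unfolding k_def by (metis (mono_tags, lifting) LeastI_ex)+
  have "S i \<in> stable_sets V E" "rho n v (S k) < rho n v (S i)"
    using lex im k a by (auto simp: lex_indexing_def bij_betw_def)
  then obtain j where j: "j \<in> {1..n}" "v j \<in> S i - S k"
    "\<And>h. h \<in> {1..<j} \<Longrightarrow> v h \<in> S k \<Longrightarrow> {v h, v j} \<notin> E"
    using lex_smaller_imp_undominated_vertex[OF inj] by metis
  obtain l where l: "l \<in> Poly_Mapping.keys a" "i < l" "v j \<in> S l"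
    using later[of "\<lambda>h. v j \<in> S h"] count[of j] j by auto
  have "k \<le> l" unfolding k_def using l by (intro Least_le) auto
  moreover have "k \<noteq> l" using l j by auto
  moreover have "\<not> dominates n v E (S k) (S l)"
    using j l by (auto simp: dominates_def)
  ultimately show ?thesis using that k l by (metis le_neq_implies_less)
qed

theorem theorem3p1:
  fixes V :: "'v set" and E :: "'v set set"
    and n m :: nat and v :: "nat \<Rightarrow> 'v" and S :: "nat \<Rightarrow> 'v set"
  assumes "simple_graph V E"
    and "perfect_ordering V E n v"
    and "lex_indexing V E n v m S"
  shows "squarefree_quadratic m
           (initial_ideal m revlex_greater (toric_ideal n v m S :: ('k::field) mpoly set))"
proof -
  define M where "M = {Poly_Mapping.single k (1::nat) + Poly_Mapping.single l 1 | k l.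
    k \<in> {1..m} \<and> l \<in> {1..m} \<and> k < l \<and> \<not> dominates n v E (S k) (S l)}"
  define X where "X = {Poly_Mapping.single a (1::'k) | a.
    \<exists>p\<in>(toric_ideal n v m S :: 'k mpoly set). p \<noteq> 0 \<and> is_initial_monomial revlex_greater p a}"
  define Y where "Y = (\<lambda>a. Poly_Mapping.single a (1::'k)) ` M"
  have inj: "inj_on v {1..n}"
    using assms(2) by (auto simp: perfect_ordering_def bij_betw_def)
  have "ideal_generated m X \<subseteq> ideal_generated m Y"
  proof (rule ideal_generated_subset)
    fix x assume "x \<in> X"
    then obtain a and p :: "'k mpoly" where x: "x = Poly_Mapping.single a 1"
      and p: "p \<in> toric_ideal n v m S" and ini: "is_initial_monomial revlex_greater p a"
      unfolding X_def by blast
    have ap: "a \<in> Poly_Mapping.keys p" using ini by (simp add: is_initial_monomial_def)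
    have sub: "Poly_Mapping.keys c \<subseteq> {1..m}" if "c \<in> Poly_Mapping.keys p" for c
      using p that by (auto simp: toric_ideal_def poly_ring_def)
    obtain b where b: "b \<in> Poly_Mapping.keys p" "b \<noteq> a"
      "toric_exponent n v S b = toric_exponent n v S a"
      using toric_fibre[of n v S p a] p ap by (auto simp: toric_ideal_def)
    then have "revlex_greater a b" using ini by (simp add: is_initial_monomial_def)
    then obtain k l where kl: "k \<in> Poly_Mapping.keys a" "l \<in> Poly_Mapping.keys a" "k < l"
      "\<not> dominates n v E (S k) (S l)"
      using revlex_greater_in_fibre_has_undominated_pair
        [OF inj assms(3) sub[OF ap] sub[OF b(1)] b(3)[symmetric]] by blast
    define g where "g = Poly_Mapping.single k (1::nat) + Poly_Mapping.single l 1"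
    have "k \<in> {1..m}" "l \<in> {1..m}" using kl sub[OF ap] by blast+
    then have "g \<in> M" using kl(3,4) unfolding M_def g_def by blast
    \<comment> \<open>Subtraction of exponents truncates, so this says that the monomial \<open>g\<close> divides \<open>a\<close>.\<close>
    have "a = (a - g) + g"
    proof (rule poly_mapping_eqI)
      fix i
      have "Poly_Mapping.lookup g i \<le> Poly_Mapping.lookup a i"
        using kl by (auto simp: g_def lookup_add lookup_single when_def in_keys_iff)
      then show "Poly_Mapping.lookup a i = Poly_Mapping.lookup ((a - g) + g) i"
        by (simp add: lookup_add lookup_minus)
    qed
    then have "x = Poly_Mapping.single (a - g) 1 * Poly_Mapping.single g 1"
      by (simp add: x Poly_Mapping.mult_single)
    moreover have "Poly_Mapping.keys (a - g) \<subseteq> {1..m}"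
      using sub[OF ap] by (auto simp: in_keys_iff lookup_minus)
    ultimately show "\<exists>s\<in>poly_ring m. \<exists>y\<in>Y. x = s * y"
      using \<open>g \<in> M\<close> by (auto simp: Y_def intro!: bexI[of _ "Poly_Mapping.single (a - g) 1"] poly_ring_single)
  qed
  moreover have "ideal_generated m Y \<subseteq> ideal_generated m X"
  proof (rule ideal_generated_subset)
    fix y assume "y \<in> Y"
    then obtain k l where kl: "k \<in> {1..m}" "l \<in> {1..m}" "k < l" "\<not> dominates n v E (S k) (S l)"
      and y: "y = Poly_Mapping.single (Poly_Mapping.single k 1 + Poly_Mapping.single l 1) 1"
      unfolding Y_def M_def by blast
    have "y \<in> X"
      unfolding X_def y using undominated_pair_initial[OF assms kl, where 'k = 'k] by blast
    then show "\<exists>s\<in>poly_ring m. \<exists>x\<in>X. y = s * x"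
      by (intro bexI[of _ 1] bexI[of _ y]) (auto simp: poly_ring_def)
  qed
  ultimately have "initial_ideal m revlex_greater (toric_ideal n v m S :: 'k mpoly set) =
      ideal_generated m Y"
    by (auto simp: initial_ideal_def X_def)
  moreover have "Poly_Mapping.keys a \<subseteq> {1..m} \<and> monomial_degree a = 2 \<and>
      (\<forall>i. Poly_Mapping.lookup a i \<le> 1)" if a: "a \<in> M" for a
  proof -
    obtain k l where kl: "k \<in> {1..m}" "l \<in> {1..m}" "k < l"
      "a = Poly_Mapping.single k (1::nat) + Poly_Mapping.single l 1"
      using a unfolding M_def by blast
    then show ?thesis
      using pair_keys[OF kl(1,2)] pair_degree[OF kl(1,2)]
      by (simp add: lookup_add lookup_single when_def)
  qed
  ultimately show ?thesis
    unfolding squarefree_quadratic_def Y_def by (intro exI[of _ M] conjI ballI) simp_all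
qed

end
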